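(* Let $\mathbb{F}_q$ be the finite field with $q$ elements and let $n\geq 1$. For $A\in\mathbb{F}_q^{n\times n}$ let $k_0=\dim\{v\in \mathbb{F}_q^n\mid vA=0\}$ and $m_0=\dim\{v\in \mathbb{F}_q^n\mid vA^n=0\}$. Let $\pi$ be the probability that a uniformly random matrix $A\in\mathbb{F}_q^{n\times n}$ does not satisfy $k_0+m_0/2\leq n$. Then $$\pi<2q^{-\lceil 2n/3\rceil}.$$
   Context: Elements of $\mathbb{F}_q^n$ are row vectors and matrices act on the right. *)

theory Defs
  imports "HOL-Probability.Probability"
begin

text \<open>The \<open>times\<close> instance of \<open>vec\<close> is the componentwise product, so \<open>A ^ n\<close> would not be the
  matrix power.\<close>

primrec matpow :: "'a::semiring_1^'n^'n \<Rightarrow> nat \<Rightarrow> 'a^'n^'n" where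
  "matpow A 0 = mat 1"
| "matpow A (Suc k) = A ** matpow A k"

end

theory Submission
  imports Defs
begin

text \<open>Write \<open>m\<close> for the dimension of the nilspace of \<open>A\<close>, the set of the vectors that some power of
  \<open>A\<close> kills. As the kernel of \<open>A\<close> lies in it, \<open>k\<^sub>0 + m\<^sub>0 / 2 > n\<close> implies \<open>m > 2 * n / 3\<close>. So
  the theorem follows, by summing a geometric series of ratio \<open>1 / q \<le> 1 / 2\<close>, once it is known that
  the nilspace has dimension exactly \<open>m\<close> with probability at most \<open>1 / q ^ m\<close> (\<open>card_nilspace_dim\<close>).

  That probability is in fact \<open>\<phi>\<^sub>n / \<phi>\<^sub>m / q ^ m\<close>, where \<open>\<phi>\<^sub>k\<close> is the product of the
  \<open>1 - 1 / q ^ j\<close> for \<open>1 \<le> j \<le> k\<close>; for \<open>m = 0\<close> this is the count of the invertible matrices, for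
  \<open>m = n\<close> the theorem of Fine and Herstein on nilpotent matrices. The upper bound is obtained by
  counting pairs of a linear map and a vector \<open>v\<close> of its nilspace, each map occurring \<open>q ^ m\<close> times.
  The orbit of \<open>v\<close> ends in \<open>0\<close>, and it is uncovered backwards from there: whenever the map is known
  on a subspace \<open>U\<close>, and the orbit is known to enter \<open>U\<close> at \<open>w\<close>, either \<open>v = w\<close>, or the vector
  before \<open>w\<close> is adjoined to \<open>U\<close>. This yields a recursion over the dimension of \<open>U\<close>
  (\<open>card_entering\<close>), which stops when \<open>U\<close> is the whole nilspace. The map is then injective modulo
  \<open>U\<close>, and such maps are counted like invertible matrices (\<open>card_nilspace_eq\<close>).\<close>

abbreviation lin :: "('a::field^'n \<Rightarrow> 'a^'n) \<Rightarrow> bool" where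
  "lin \<equiv> Vector_Spaces.linear (*s) (*s)"

section \<open>Elements of subspaces and injective maps\<close>

lemma card_subspace:
  fixes S :: "('a::{field,finite}^'n) set"
  assumes "vec.subspace S"
  shows "card S = CARD('a) ^ vec.dim S"
proof -
  have span: "card (vec.span B) = CARD('a) ^ card B" if "vec.independent B" for B :: "('a^'n) set"
    using finite[of B] that
  proof (induction B rule: finite_induct)
    case empty
    then show ?case by simp
  next
    case (insert b B)
    have b: "b \<notin> vec.span B" and B: "vec.independent B"
      using insert.prems insert.hyps by (simp_all add: vec.independent_insert)
    have "bij_betw (\<lambda>(c, s). c *s b + s) (UNIV \<times> vec.span B) (vec.span (insert b B))"
    proof (rule bij_betw_imageI)
      show "inj_on (\<lambda>(c, s). c *s b + s) (UNIV \<times> vec.span B)"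
      proof (rule inj_onI, clarify)
        fix c s c' s'
        assume s: "s \<in> vec.span B" "s' \<in> vec.span B" and eq: "c *s b + s = c' *s b + s'"
        define d where "d = c - c'"
        have "d *s b = s' - s"
          using eq by (simp add: d_def vec.scale_left_diff_distrib algebra_simps)
        then have "inverse d *s (d *s b) \<in> vec.span B"
          using s by (simp add: vec.span_diff vec.span_scale)
        then have "d = 0"
          using b by (cases "d = 0") simp_all
        then have "c = c'" by (simp add: d_def)
        then show "c = c' \<and> s = s'" using eq by simp
      qed
      show "(\<lambda>(c, s). c *s b + s) ` (UNIV \<times> vec.span B) = vec.span (insert b B)"
      proof (intro equalityI subsetI)
        fix x assume "x \<in> (\<lambda>(c, s). c *s b + s) ` (UNIV \<times> vec.span B)"
        then obtain c s where "s \<in> vec.span B" "x = c *s b + s" by auto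
        then have "x - c *s b \<in> vec.span B" by simp
        then show "x \<in> vec.span (insert b B)"
          unfolding vec.span_insert by blast
      next
        fix x assume "x \<in> vec.span (insert b B)"
        then obtain c where "x - c *s b \<in> vec.span B"
          unfolding vec.span_insert by auto
        then show "x \<in> (\<lambda>(c, s). c *s b + s) ` (UNIV \<times> vec.span B)"
          by (intro image_eqI[of _ _ "(c, x - c *s b)"]) auto
      qed
    qed
    from bij_betw_same_card[OF this] show ?case
      using insert.IH[OF B] insert.hyps by (simp add: card_cartesian_product)
  qed
  obtain B where "B \<subseteq> S" "vec.independent B" "S \<subseteq> vec.span B" "card B = vec.dim S"
    using vec.basis_exists by blast
  then show ?thesis
    using span[of B] vec.span_subspace[OF _ _ assms] by metis
qed

lemma card_le_cover:
  fixes c :: real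
  assumes "M \<subseteq> (\<Union>y\<in>Y. F y)" "finite Y" "\<And>y. y \<in> Y \<Longrightarrow> finite (F y)"
    and "\<And>y. y \<in> Y \<Longrightarrow> real (card (F y)) \<le> c"
  shows "real (card M) \<le> real (card Y) * c"
proof -
  have "card M \<le> card (\<Union>y\<in>Y. F y)"
    using assms by (intro card_mono) auto
  also have "\<dots> \<le> (\<Sum>y\<in>Y. card (F y))"
    by (rule card_UN_le) fact
  finally have "real (card M) \<le> (\<Sum>y\<in>Y. real (card (F y)))"
    by (simp flip: of_nat_sum)
  also have "\<dots> \<le> real (card Y) * c"
    using assms(4) by (rule sum_bounded_above)
  finally show ?thesis .
qed

text \<open>This is the proportion of invertible matrices among the \<open>k\<close> by \<open>k\<close> matrices over a field with
  \<open>q\<close> elements.\<close>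

definition gl_density :: "nat \<Rightarrow> nat \<Rightarrow> real" where
  "gl_density q k = (\<Prod>j=1..k. 1 - 1 / real q ^ j)"

lemma gl_density_0 [simp]: "gl_density q 0 = 1"
  by (simp add: gl_density_def)

lemma gl_density_Suc: "gl_density q (Suc k) = (1 - 1 / real q ^ Suc k) * gl_density q k"
  by (simp add: gl_density_def mult.commute)

lemma gl_density_pos:
  assumes "q \<ge> 2" shows "gl_density q k > 0"
  unfolding gl_density_def
proof (rule prod_pos)
  fix j assume "j \<in> {1..k}"
  then have "real q ^ j > 1" using assms by (intro one_less_power) auto
  then show "1 - 1 / real q ^ j > 0" by (simp add: divide_less_eq)
qed

lemma gl_density_antimono:
  assumes "q \<ge> 2" "k \<le> l" shows "gl_density q l \<le> gl_density q k"
  using assms(2)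
proof (induction l rule: dec_induct)
  case (step l)
  have "gl_density q (Suc l) \<le> 1 * gl_density q l"
    unfolding gl_density_Suc using assms(1) gl_density_pos[of q l]
    by (intro mult_right_mono) auto
  with step show ?case by simp
qed simp

lemma card_field_ge_2: "CARD('a::{field,finite}) \<ge> 2"
proof -
  have "card {0, 1 :: 'a} \<le> CARD('a)" by (rule card_mono) auto
  then show ?thesis by simp
qed

lemma card_compl_subspace:
  fixes S :: "('a::{field,finite}^'n) set"
  assumes "vec.subspace S" and d: "vec.dim S + k = CARD('n)"
  shows "real (card (- S)) = real CARD('a) ^ CARD('n) * (1 - 1 / real CARD('a) ^ k)"
proof -
  have "card (- S) = CARD('a) ^ CARD('n) - CARD('a) ^ vec.dim S"
    using card_subspace[OF assms(1)] by (simp add: Compl_eq_Diff_UNIV card_Diff_subset)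
  moreover have "CARD('a) ^ vec.dim S \<le> CARD('a) ^ CARD('n)"
    using d card_field_ge_2[where 'a='a] by (intro power_increasing) auto
  ultimately have "real (card (- S)) = real CARD('a) ^ CARD('n) - real CARD('a) ^ vec.dim S"
    by (simp add: of_nat_diff)
  moreover have "real CARD('a) ^ CARD('n) = real CARD('a) ^ vec.dim S * real CARD('a) ^ k"
    by (simp flip: d power_add)
  moreover have "real CARD('a) > 0" by simp
  ultimately show ?thesis by (simp add: right_diff_distrib)
qed

text \<open>An injective map is extended one dimension at a time: a new vector may be sent anywhere outside
  the image of \<open>D\<close>, which has as many elements as \<open>D\<close>.\<close>

lemma card_injective_extensions:
  fixes D :: "('a::{field,finite}^'n) set"
  assumes "vec.subspace D" and "vec.dim D + k = CARD('n)"
  shows "real (card {f. lin f \<and> inj f \<and> (\<forall>x\<in>D. f x = g x)})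
           \<le> real CARD('a) ^ (CARD('n) * k) * gl_density CARD('a) k"
  using assms
proof (induction k arbitrary: D g)
  case 0
  then have "D = UNIV"
    using vec.dim_eq_full[of D] vec.span_eq_iff[of D] by (simp add: vec.dimension_def card_cart_basis)
  then have "{f. lin f \<and> inj f \<and> (\<forall>x\<in>D. f x = g x)} \<subseteq> {g}" by auto
  then have "card {f. lin f \<and> inj f \<and> (\<forall>x\<in>D. f x = g x)} \<le> card {g}"
    by (intro card_mono) auto
  then show ?case by simp
next
  case (Suc k)
  let ?q = "real CARD('a)" and ?n = "CARD('n)"
  let ?M = "{f. lin f \<and> inj f \<and> (\<forall>x\<in>D. f x = g x)}"
  let ?c = "?q ^ (?n * k) * gl_density CARD('a) k"
  have q: "CARD('a) \<ge> 2" by (rule card_field_ge_2)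
  have c: "?c \<ge> 0" using gl_density_pos[OF q, of k] by simp
  show ?case
  proof (cases "?M = {}")
    case True
    then show ?thesis using gl_density_pos[OF q, of "Suc k"] by (simp only: card.empty) simp
  next
    case False
    then obtain f0 where f0: "lin f0" "inj f0" "\<forall>x\<in>D. f0 x = g x" by blast
    interpret f0: Vector_Spaces.linear "(*s)" "(*s)" f0 by (fact f0)
    have "D \<noteq> UNIV"
      using Suc.prems by (auto simp: card_cart_basis)
    then obtain w where w: "w \<notin> D" by blast
    define D' where "D' = vec.span (insert w D)"
    have D': "vec.subspace D'" "vec.dim D' + k = ?n"
      using w Suc.prems by (auto simp: D'_def vec.dim_insert vec.span_eq_iff[THEN iffD2])
    have "real (card ?M) \<le> real (card (- f0 ` D)) * ?c"
    proof (rule card_le_cover[where F = "\<lambda>y. {f \<in> ?M. f w = y}"])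
      show "?M \<subseteq> (\<Union>y\<in>- f0 ` D. {f \<in> ?M. f w = y})"
      proof
        fix f assume f: "f \<in> ?M"
        have "f w \<noteq> f0 x" if "x \<in> D" for x
          using f f0 that w by (metis (mono_tags, lifting) injD mem_Collect_eq)
        then show "f \<in> (\<Union>y\<in>- f0 ` D. {f \<in> ?M. f w = y})" using f by auto
      qed
      show "real (card {f \<in> ?M. f w = y}) \<le> ?c" for y
      proof (cases "{f \<in> ?M. f w = y} = {}")
        case True
        then show ?thesis using c by (metis card.empty of_nat_0)
      next
        case False
        then obtain f1 where f1: "f1 \<in> ?M" "f1 w = y" by blast
        have "{f \<in> ?M. f w = y} \<subseteq> {f. lin f \<and> inj f \<and> (\<forall>x\<in>D'. f x = f1 x)}"
          using f1 by (auto simp: D'_def intro: vec.linear_eq_on[where B = "insert w D"])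
        then have "card {f \<in> ?M. f w = y} \<le> card {f. lin f \<and> inj f \<and> (\<forall>x\<in>D'. f x = f1 x)}"
          by (intro card_mono) auto
        with Suc.IH[OF D', of f1] show ?thesis by linarith
      qed
    qed auto
    also have "real (card (- f0 ` D)) = ?q ^ ?n * (1 - 1 / ?q ^ Suc k)"
    proof (rule card_compl_subspace)
      show "vec.subspace (f0 ` D)"
        using Suc.prems f0.subspace_image by blast
      have "vec.dim (f0 ` D) = vec.dim D"
        using f0 by (intro vec.dim_image_eq) (auto intro: inj_on_subset)
      then show "vec.dim (f0 ` D) + Suc k = ?n" using Suc.prems by simp
    qed
    finally show ?thesis by (simp add: gl_density_Suc power_add mult_ac)
  qed
qed

section \<open>Counting maps by the dimension of their nilspace\<close>

definition nilspace :: "('b::zero \<Rightarrow> 'b) \<Rightarrow> 'b set" where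
  "nilspace f = {v. \<exists>k. (f ^^ k) v = 0}"

lemma lin_funpow: "lin f \<Longrightarrow> lin (f ^^ k)"
  by (induction k) (auto simp: vec.linear_id intro: Vector_Spaces.linear_compose)

lemma subspace_nilspace:
  fixes f :: "'a::field^'n \<Rightarrow> 'a^'n"
  assumes f: "lin f" shows "vec.subspace (nilspace f)"
proof (rule vec.subspaceI)
  have z: "(f ^^ k) 0 = 0" for k
    using lin_funpow[OF f] by (rule vec.linear_0)
  show "0 \<in> nilspace f" by (auto simp: nilspace_def z)
  fix x y c
  assume "x \<in> nilspace f"
  then obtain k where k: "(f ^^ k) x = 0" by (auto simp: nilspace_def)
  then have "(f ^^ k) (c *s x) = 0"
    using vec.linear_scale[OF lin_funpow[OF f]] by (simp add: vec.scale_zero_right)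
  then show "c *s x \<in> nilspace f" by (auto simp: nilspace_def)
  assume "y \<in> nilspace f"
  then obtain l where l: "(f ^^ l) y = 0" by (auto simp: nilspace_def)
  have "(f ^^ (l + k)) x = 0" "(f ^^ (k + l)) y = 0"
    using k l by (simp_all add: funpow_add z)
  then have "(f ^^ (k + l)) (x + y) = 0"
    using vec.linear_add[OF lin_funpow[OF f]] by (simp add: add.commute)
  then show "x + y \<in> nilspace f" by (auto simp: nilspace_def)
qed

lemma funpow_eq_on:
  assumes "\<And>x. x \<in> U \<Longrightarrow> f x = g x" "\<And>x. x \<in> U \<Longrightarrow> g x \<in> U" "x \<in> U"
  shows "(f ^^ k) x = (g ^^ k) x \<and> (g ^^ k) x \<in> U"
  by (induction k) (use assms in auto)

lemma subset_nilspace: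
  assumes "\<And>x. x \<in> U \<Longrightarrow> f x = g x" "\<And>x. x \<in> U \<Longrightarrow> g x \<in> U" "U \<subseteq> nilspace g"
  shows "U \<subseteq> nilspace f"
proof
  fix x assume x: "x \<in> U"
  then obtain k where "(g ^^ k) x = 0" using assms(3) by (auto simp: nilspace_def)
  moreover have "(f ^^ k) x = (g ^^ k) x"
    using funpow_eq_on[OF assms(1,2) x] by simp
  ultimately show "x \<in> nilspace f" by (auto simp: nilspace_def)
qed

text \<open>For \<open>w \<in> U\<close>, the only case of interest below, this makes \<open>w\<close> the first point of \<open>U\<close> on the orbit
  of \<open>v\<close>; in particular \<open>v = w\<close> if \<open>v \<in> U\<close>.\<close>

definition enters :: "('b \<Rightarrow> 'b) \<Rightarrow> 'b set \<Rightarrow> 'b \<Rightarrow> 'b \<Rightarrow> bool" where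
  "enters f U w v \<longleftrightarrow> (\<exists>k. (f ^^ k) v = w \<and> (\<forall>i<k. (f ^^ i) v \<notin> U))"

lemma card_Sigma_nilspace:
  fixes N :: "('a::{field,finite}^'n \<Rightarrow> 'a^'n) set"
  assumes "\<And>f. f \<in> N \<Longrightarrow> lin f \<and> vec.dim (nilspace f) = m"
  shows "card (SIGMA f:N. nilspace f) = CARD('a) ^ m * card N"
proof -
  have "card (SIGMA f:N. nilspace f) = (\<Sum>f\<in>N. card (nilspace f))"
    by (rule card_SigmaI) auto
  also have "\<dots> = (\<Sum>f\<in>N. CARD('a) ^ m)"
    by (intro sum.cong refl) (use assms in \<open>auto simp: card_subspace subspace_nilspace\<close>)
  finally show ?thesis by (simp add: mult.commute)
qed

text \<open>Replacing \<open>f\<close> on \<open>U\<close> by the identity, with the help of a projection \<open>p\<close> onto \<open>U\<close>, loses no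
  information, because \<open>f\<close> is prescribed there. The new map is invertible when \<open>U\<close> is the whole
  nilspace: then \<open>f x \<in> U\<close> forces \<open>x \<in> U\<close>, that is, \<open>f\<close> is injective modulo \<open>U\<close>.\<close>

lemma card_nilspace_eq:
  fixes U :: "('a::{field,finite}^'n) set"
  assumes U: "vec.subspace U"
    and l: "vec.dim U + l = CARD('n)"
  shows "real (card {f. lin f \<and> (\<forall>x\<in>U. f x = g x) \<and> nilspace f = U})
           \<le> real CARD('a) ^ (CARD('n) * l) * gl_density CARD('a) l" (is "real (card ?M) \<le> _")
proof -
  obtain p where p: "range p \<subseteq> U" "lin p" "\<And>x. x \<in> U \<Longrightarrow> p x = x"
    using vec.linear_exists_left_inverse_on[OF vec.linear_id U] by auto
  interpret p: Vector_Spaces.linear "(*s)" "(*s)" p by (fact p)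
  have pU: "p x \<in> U" for x using p(1) by auto
  define t where "t f x = f (x - p x) + p x" for f :: "'a^'n \<Rightarrow> 'a^'n" and x
  have "t ` ?M \<subseteq> {f. lin f \<and> inj f \<and> (\<forall>x\<in>U. f x = x)}"
  proof clarify
    fix f assume f: "lin f" and nil: "U = nilspace f"
    interpret f: Vector_Spaces.linear "(*s)" "(*s)" f by (fact f)
    have lin: "lin (t f)"
      by unfold_locales (simp_all add: t_def f.add f.diff f.scale p.add p.scale algebra_simps
          vec.scale_right_distrib vec.scale_right_diff_distrib)
    moreover have "inj (t f)"
    proof (subst vec.linear_inj_iff_eq_0[OF lin], intro allI impI)
      fix x assume tx: "t f x = 0"
      have "f (x - p x) = - p x" using tx by (simp add: t_def eq_neg_iff_add_eq_0)
      then have "f (x - p x) \<in> U" using pU vec.subspace_neg[OF U] by metis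
      then obtain k where "(f ^^ Suc k) (x - p x) = 0"
        unfolding nil nilspace_def funpow_Suc_right by auto
      then have "x - p x \<in> U" unfolding nil nilspace_def by blast
      then have "x \<in> U" using vec.subspace_add[OF U _ pU[of x]] by fastforce
      with tx show "x = 0" by (simp add: t_def p f.zero)
    qed
    moreover have "t f x = x" if "x \<in> nilspace f" for x
      using that by (simp add: t_def p f.zero nil)
    ultimately show "lin (t f) \<and> inj (t f) \<and> (\<forall>x\<in>nilspace f. t f x = x)" by blast
  qed
  then have "card (t ` ?M) \<le> card {f :: 'a^'n \<Rightarrow> 'a^'n. lin f \<and> inj f \<and> (\<forall>x\<in>U. f x = x)}"
    by (intro card_mono) auto
  moreover have "inj_on t ?M"
  proof (rule inj_onI)
    fix f f' assume f: "f \<in> ?M" and f': "f' \<in> ?M" and eq: "t f = t f'"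
    show "f = f'"
    proof
      fix x
      have "f (x - p x) = f' (x - p x)"
        using fun_cong[OF eq, of x] by (simp add: t_def)
      moreover have "f (p x) = f' (p x)" using f f' pU by auto
      ultimately have "f (x - p x + p x) = f' (x - p x + p x)"
        using f f' by (simp only: mem_Collect_eq vec.linear_add)
      then show "f x = f' x" by simp
    qed
  qed
  ultimately have "card ?M \<le> card {f :: 'a^'n \<Rightarrow> 'a^'n. lin f \<and> inj f \<and> (\<forall>x\<in>U. f x = x)}"
    by (simp add: card_image)
  with card_injective_extensions[OF U l, of "\<lambda>x. x"] show ?thesis by linarith
qed

text \<open>This is the heart of the counting, a downward induction on \<open>dim U\<close>. Let \<open>N\<close> be the set of the
  extensions \<open>f\<close> of \<open>g\<close> from \<open>U\<close> whose nilspace has dimension \<open>m\<close>, and \<open>R w\<close> the set of the pairs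
  \<open>(f, v)\<close> such that the orbit of \<open>v\<close> enters \<open>U\<close> at \<open>w\<close>. Two inequalities tie their sizes together.

  \<^item> If \<open>(f, v) \<in> R w\<close> and \<open>v \<noteq> w\<close>, let \<open>y\<close> be the last point of the orbit before \<open>w\<close>. Then \<open>y \<notin> U\<close>,
    and \<open>y\<close> is also the point where the orbit enters \<open>span (insert y U)\<close>. For fixed \<open>y\<close> the values of
    \<open>f\<close> on this larger subspace are known, so the induction hypothesis bounds the number of such
    pairs by some \<open>c\<close>. Hence \<open>\<bar>R w\<bar> \<le> \<bar>N\<bar> + X\<close> where \<open>X = \<bar>- U\<bar> * c\<close>.

  \<^item> Each of the \<open>q ^ m\<close> vectors of the nilspace of \<open>f\<close> enters \<open>U\<close> somewhere, since its orbit reaches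
    \<open>0\<close>. Hence \<open>q ^ m * \<bar>N\<bar>\<close> is at most the sum of the \<open>\<bar>R w\<bar>\<close> over the \<open>q ^ u\<close> elements \<open>w\<close> of \<open>U\<close>.

  Eliminating the unknown \<open>\<bar>N\<bar>\<close> gives \<open>\<bar>R w\<bar> \<le> X / (1 - q ^ u / q ^ m)\<close>, and these denominators
  make up \<open>gl_density q k\<close> in the bound.\<close>

lemma card_entering:
  fixes U :: "('a::{field,finite}^'n) set" and g :: "'a^'n \<Rightarrow> 'a^'n"
  assumes "vec.subspace U" and "\<And>x. x \<in> U \<Longrightarrow> g x \<in> U" and "U \<subseteq> nilspace g" and "w \<in> U"
    and "vec.dim U + k = m" and "m + l = CARD('n)"
  shows "real (card {(f, v). lin f \<and> (\<forall>x\<in>U. f x = g x) \<and> vec.dim (nilspace f) = m \<and> enters f U w v})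
           \<le> real CARD('a) ^ (CARD('n) * (k + l)) * gl_density CARD('a) (k + l) / gl_density CARD('a) k"
  using assms
proof (induction k arbitrary: U g w)
  case 0
  let ?M = "{f. lin f \<and> (\<forall>x\<in>U. f x = g x) \<and> nilspace f = U}"
  \<comment> \<open>Here \<open>U\<close> fills the whole nilspace, so \<open>v\<close> lies in \<open>U\<close> and its orbit enters \<open>U\<close> at \<open>v\<close> itself.\<close>
  have "{(f, v). lin f \<and> (\<forall>x\<in>U. f x = g x) \<and> vec.dim (nilspace f) = m \<and> enters f U w v}
      \<subseteq> ?M \<times> {w}"
  proof (clarify, intro SigmaI CollectI conjI)
    fix f v assume f: "lin f" "\<forall>x\<in>U. f x = g x" "m = vec.dim (nilspace f)" and en: "enters f U w v"
    have "U \<subseteq> nilspace f" using f 0 by (intro subset_nilspace[of _ f g]) auto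
    then have U: "nilspace f = U"
      using vec.subspace_dim_equal[OF 0(1) subspace_nilspace[OF f(1)]] 0 f by simp
    show "lin f" "\<forall>x\<in>U. f x = g x" "nilspace f = U" by fact+
    obtain j where j: "(f ^^ j) v = w" "\<forall>i<j. (f ^^ i) v \<notin> U" using en by (auto simp: enters_def)
    have "w \<in> nilspace f" using 0 U by simp
    then obtain i where "(f ^^ i) w = 0" by (auto simp: nilspace_def)
    then have "(f ^^ (i + j)) v = 0" using j by (simp add: funpow_add)
    then have "v \<in> U" unfolding U[symmetric] nilspace_def by blast
    with j show "v \<in> {w}" by (cases j) auto
  qed
  then have "card {(f, v). lin f \<and> (\<forall>x\<in>U. f x = g x) \<and> vec.dim (nilspace f) = m \<and> enters f U w v}
      \<le> card (?M \<times> {w})"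
    by (intro card_mono) auto
  also have "\<dots> = card ?M" by (simp add: card_cartesian_product)
  finally show ?case
    using card_nilspace_eq[of U l g] 0 by simp
next
  case (Suc k)
  let ?q = "real CARD('a)" and ?n = "CARD('n)"
  define u where "u = vec.dim U"
  define N where "N = {f. lin f \<and> (\<forall>x\<in>U. f x = g x) \<and> vec.dim (nilspace f) = m}"
  define R where "R w = {(f, v). f \<in> N \<and> enters f U w v}" for w
  define c where "c = ?q ^ (?n * (k + l)) * gl_density CARD('a) (k + l) / gl_density CARD('a) k"
  define X where "X = real (card (- U)) * c"
  have q: "CARD('a) \<ge> 2" by (rule card_field_ge_2)
  have c: "c \<ge> 0" using gl_density_pos[OF q] by (simp add: c_def less_imp_le)
  have R: "real (card (R w)) \<le> real (card N) + X" if w: "w \<in> U" for w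
  proof -
    define F where "F y = {(f, v). f \<in> N \<and> f y = w \<and> enters f (vec.span (insert y U)) y v}" for y
    have "R w \<subseteq> N \<times> {w} \<union> (\<Union>y\<in>-U. F y)"
    proof clarify
      fix f v assume fv: "(f, v) \<in> R w" and F: "(f, v) \<notin> (\<Union>y\<in>- U. F y)"
      have f: "f \<in> N" "lin f" "enters f U w v" using fv by (auto simp: R_def N_def)
      have fU: "f x \<in> U" if "x \<in> U" for x using f Suc.prems(2) that by (auto simp: N_def)
      obtain j where j: "(f ^^ j) v = w" "\<forall>i<j. (f ^^ i) v \<notin> U" using f by (auto simp: enters_def)
      show "f \<in> N \<and> v \<in> {w}"
      proof (cases j)
        case 0
        then show ?thesis using j f by simp
      next
        case (Suc j')
        define y where "y = (f ^^ j') v"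
        have y: "y \<in> - U" "f y = w" using j Suc by (auto simp: y_def)
        \<comment> \<open>A point of \<open>span (insert y U)\<close> is mapped into \<open>U\<close>, so the orbit would enter \<open>U\<close> too early.\<close>
        have "(f ^^ i) v \<notin> vec.span (insert y U)" if i: "i < j'" for i
        proof
          assume "(f ^^ i) v \<in> vec.span (insert y U)"
          then obtain a where "(f ^^ i) v - a *s y \<in> U"
            using Suc.prems(1) by (auto simp: vec.span_insert vec.span_eq_iff[THEN iffD2])
          then have "f ((f ^^ i) v - a *s y) \<in> U" by (rule fU)
          then have "f ((f ^^ i) v) - a *s w \<in> U"
            using y by (simp add: vec.linear_diff[OF f(2)] vec.linear_scale[OF f(2)])
          then have "(f ^^ Suc i) v \<in> U"
            using vec.subspace_add[OF Suc.prems(1) _ vec.subspace_scale[OF Suc.prems(1) w, of a]]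
            by fastforce
          then show False using j i Suc by auto
        qed
        then have "(f, v) \<in> F y"
          using f y by (auto simp: F_def enters_def y_def)
        with F y show ?thesis by blast
      qed
    qed
    then have "card (R w) \<le> card (N \<times> {w} \<union> (\<Union>y\<in>-U. F y))"
      by (intro card_mono) auto
    also have "\<dots> \<le> card (N \<times> {w}) + card (\<Union>y\<in>-U. F y)" by (rule card_Un_le)
    finally have "card (R w) \<le> card N + card (\<Union>y\<in>-U. F y)"
      by (simp add: card_cartesian_product)
    moreover have "real (card (\<Union>y\<in>-U. F y)) \<le> X"
      unfolding X_def
    proof (rule card_le_cover[where F = F])
      fix y assume "y \<in> - U"
      then have y: "y \<notin> U" by simp
      show "real (card (F y)) \<le> c"
      proof (cases "F y = {}")
        case True
        then show ?thesis using c by simp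
      next
        case False
        \<comment> \<open>Any member of the fibre serves as the prescribed map on the larger subspace, so that no
          extension of \<open>g\<close> need be constructed.\<close>
        then obtain h where h: "h \<in> N" "h y = w" by (auto simp: F_def)
        define U' where "U' = vec.span (insert y U)"
        interpret h: Vector_Spaces.linear "(*s)" "(*s)" h using h by (simp add: N_def)
        have UU': "insert y U \<subseteq> U'" by (simp add: U'_def vec.span_superset)
        have hU: "h x \<in> U" if "x \<in> insert y U" for x
          using that h w Suc.prems(2) by (auto simp: N_def)
        have U': "vec.subspace U'" by (simp add: U'_def)
        have "F y \<subseteq> {(f, v). lin f \<and> (\<forall>x\<in>U'. f x = h x) \<and> vec.dim (nilspace f) = m \<and> enters f U' y v}"
        proof clarify
          fix f v assume "(f, v) \<in> F y"
          then have f: "f \<in> N" "f y = w" "enters f U' y v" by (auto simp: F_def U'_def)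
          have "f x = h x" if "x \<in> U'" for x
          proof (rule vec.linear_eq_on[of f h x "insert y U"])
            show "lin f" "lin h" using f h by (auto simp: N_def)
            show "x \<in> vec.span (insert y U)" using that by (simp add: U'_def)
          qed (use f h in \<open>auto simp: N_def\<close>)
          then show "lin f \<and> (\<forall>x\<in>U'. f x = h x) \<and> vec.dim (nilspace f) = m \<and> enters f U' y v"
            using f by (simp add: N_def)
        qed
        then have "card (F y) \<le> card {(f, v). lin f \<and> (\<forall>x\<in>U'. f x = h x) \<and>
            vec.dim (nilspace f) = m \<and> enters f U' y v}"
          by (intro card_mono) auto
        moreover have "real (card {(f, v). lin f \<and> (\<forall>x\<in>U'. f x = h x) \<and>
            vec.dim (nilspace f) = m \<and> enters f U' y v}) \<le> c"
          unfolding c_def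
        proof (rule Suc.IH[OF U'])
          have "h ` U' = vec.span (h ` insert y U)"
            unfolding U'_def by (rule vec.linear_span_image[symmetric]) (use h in \<open>simp add: N_def\<close>)
          also have "\<dots> \<subseteq> U" using hU Suc.prems(1) by (intro vec.span_minimal) auto
          finally have hU': "h x \<in> U" if "x \<in> U'" for x using that by blast
          then show "h x \<in> U'" if "x \<in> U'" for x using that UU' by blast
          have "U \<subseteq> nilspace h"
            using h Suc.prems by (intro subset_nilspace[of _ h g]) (auto simp: N_def)
          show "U' \<subseteq> nilspace h"
          proof
            fix x assume "x \<in> U'"
            then obtain i where "(h ^^ i) (h x) = 0"
              using hU' \<open>U \<subseteq> nilspace h\<close> by (fastforce simp: nilspace_def)
            then have "(h ^^ Suc i) x = 0" by (simp only: funpow_Suc_right o_apply)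
            then show "x \<in> nilspace h" unfolding nilspace_def by blast
          qed
          show "y \<in> U'" using UU' by simp
          show "vec.dim U' + k = m"
            using y Suc.prems by (simp add: U'_def vec.dim_insert vec.span_eq_iff[THEN iffD2])
        qed fact
        ultimately show ?thesis by linarith
      qed
    qed auto
    ultimately show ?thesis by linarith
  qed
  have "?q ^ m * real (card N) \<le> ?q ^ u * (real (card N) + X)"
  proof -
    have "?q ^ m * real (card N) = real (card (SIGMA f:N. nilspace f))"
      by (subst card_Sigma_nilspace[of N m]) (auto simp: N_def)
    also have "\<dots> \<le> real (card U) * (real (card N) + X)"
    proof (rule card_le_cover[where F = R])
      show "(SIGMA f:N. nilspace f) \<subseteq> (\<Union>w\<in>U. R w)"
      proof clarify
        fix f v assume f: "f \<in> N" and v: "v \<in> nilspace f"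
        obtain i where "(f ^^ i) v = 0" using v by (auto simp: nilspace_def)
        then have "(f ^^ i) v \<in> U" using vec.subspace_0[OF Suc.prems(1)] by simp
        then obtain j where "(f ^^ j) v \<in> U" "\<forall>i<j. (f ^^ i) v \<notin> U"
          using exists_least_iff[of "\<lambda>j. (f ^^ j) v \<in> U"] by blast
        then show "(f, v) \<in> (\<Union>w\<in>U. R w)" using f by (auto simp: R_def enters_def)
      qed
    qed (use R in auto)
    finally show ?thesis using card_subspace[OF Suc.prems(1)] by (simp add: u_def)
  qed
  moreover have m: "?q ^ m = ?q ^ u * ?q ^ Suc k"
    unfolding power_add[symmetric] u_def Suc.prems(5) ..
  moreover have "?q ^ u > 0" by simp
  ultimately have "?q ^ Suc k * real (card N) \<le> real (card N) + X"
    by (metis mult.assoc mult_le_cancel_left_pos)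
  then have N: "(real (card N) + X) * (1 - 1 / ?q ^ Suc k) \<le> X"
    by (simp add: field_simps)
  have "X = ?q ^ ?n * (1 - 1 / ?q ^ (Suc k + l)) * c"
    unfolding X_def by (subst card_compl_subspace[of _ "Suc k + l"]) (use Suc.prems in auto)
  also have "\<dots> = ?q ^ (?n * (Suc k + l)) * gl_density CARD('a) (Suc k + l) / gl_density CARD('a) k"
    by (simp add: c_def gl_density_Suc power_add mult_ac)
  finally have X: "X = ?q ^ (?n * (Suc k + l)) * gl_density CARD('a) (Suc k + l) / gl_density CARD('a) k" .
  have pos: "1 - 1 / ?q ^ Suc k > 0"
    using gl_density_pos[OF q, of "Suc k"] gl_density_pos[OF q, of k] unfolding gl_density_Suc
    by (simp add: zero_less_mult_iff)
  have "real (card (R w)) \<le> real (card N) + X" using Suc.prems(4) by (rule R)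
  also have "\<dots> \<le> X / (1 - 1 / ?q ^ Suc k)"
    using N pos by (simp only: pos_le_divide_eq)
  also have "\<dots> = ?q ^ (?n * (Suc k + l)) * gl_density CARD('a) (Suc k + l) / gl_density CARD('a) (Suc k)"
    unfolding X gl_density_Suc[of _ k] by simp
  finally show ?case by (simp add: R_def N_def conj_assoc)
qed

text \<open>For \<open>U = {0}\<close> nothing is prescribed, and every vector of the nilspace enters \<open>U\<close> at \<open>0\<close>. The
  factor \<open>gl_density q n / gl_density q m\<close> of the bound is at most one.\<close>

lemma card_nilspace_dim:
  "real (card {f :: 'a::{field,finite}^'n \<Rightarrow> 'a^'n. lin f \<and> vec.dim (nilspace f) = m}) * real CARD('a) ^ m
     \<le> real CARD('a) ^ (CARD('n) * CARD('n))"
proof (cases "m \<le> CARD('n)")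
  case False
  then have "{f :: 'a^'n \<Rightarrow> 'a^'n. lin f \<and> vec.dim (nilspace f) = m} = {}"
    using vec.dim_subset_UNIV by (fastforce simp: card_cart_basis vec.dimension_def)
  then show ?thesis by (simp only: card.empty) simp
next
  case True
  then obtain l where l: "m + l = CARD('n)" using le_Suc_ex by metis
  let ?N = "{f :: 'a^'n \<Rightarrow> 'a^'n. lin f \<and> vec.dim (nilspace f) = m}"
  have q: "CARD('a) \<ge> 2" by (rule card_field_ge_2)
  let ?R = "{(f :: 'a^'n \<Rightarrow> 'a^'n, v). lin f \<and> (\<forall>x\<in>{0}. f x = 0) \<and> vec.dim (nilspace f) = m \<and> enters f {0} 0 v}"
  have "real (card ?N) * real CARD('a) ^ m = real (card (SIGMA f:?N. nilspace f))"
    by (subst card_Sigma_nilspace[of ?N m]) auto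
  also have "\<dots> \<le> real (card ?R)"
  proof -
    have "(SIGMA f:?N. nilspace f) \<subseteq> ?R"
    proof (rule subrelI)
      fix f :: "'a^'n \<Rightarrow> 'a^'n" and v assume "(f, v) \<in> (SIGMA f:?N. nilspace f)"
      moreover from this have "enters f {0} 0 v"
        using exists_least_iff[of "\<lambda>j. (f ^^ j) v = 0"] by (auto simp: nilspace_def enters_def)
      ultimately show "(f, v) \<in> ?R"
        by (simp add: vec.linear_0)
    qed
    then have "card (SIGMA f:?N. nilspace f) \<le> card ?R" by (intro card_mono) auto
    then show ?thesis by (simp only: of_nat_le_iff)
  qed
  also have "\<dots> \<le> real CARD('a) ^ (CARD('n) * (m + l)) * gl_density CARD('a) (m + l) / gl_density CARD('a) m"
    by (rule card_entering[OF _ _ _ _ _ l]) (auto simp: nilspace_def vec.subspace_def intro: exI[of _ 0])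
  also have "\<dots> \<le> real CARD('a) ^ (CARD('n) * (m + l))"
    using gl_density_antimono[OF q, of m "m + l"] gl_density_pos[OF q, of m]
    by (simp add: pos_divide_le_eq mult_left_mono)
  finally show ?thesis by (simp add: l)
qed

section \<open>The probability bound\<close>

theorem mainTheorem8:
  fixes q n :: nat and \<pi> :: real
    and k0 m0 :: "'a::{field,finite}^'n^'n \<Rightarrow> nat"
  assumes "q = CARD('a)" and "n = CARD('n)" and "n \<ge> 1"
    and "\<And>A. k0 A = vec.dim {v. v v* A = 0}"
    and "\<And>A. m0 A = vec.dim {v. v v* matpow A n = 0}"
    and "\<pi> = measure_pmf.prob (pmf_of_set (UNIV :: ('a^'n^'n) set))
               {A. \<not> real (k0 A) + real (m0 A) / 2 \<le> real n}"
  shows "\<pi> < 2 * real q powi (- \<lceil>2 * real n / 3\<rceil>)"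
proof -
  let ?E = "{A. \<not> real (k0 A) + real (m0 A) / 2 \<le> real n}"
  define act where "act A = (\<lambda>v. v v* A)" for A :: "'a^'n^'n"
  define N where "N m = {f :: 'a^'n \<Rightarrow> 'a^'n. lin f \<and> vec.dim (nilspace f) = m}" for m
  define t where "t = nat \<lceil>2 * real n / 3\<rceil>"
  define x where "x = 1 / real q"
  have q: "q \<ge> 2" using card_field_ge_2[where 'a='a] assms(1) by simp
  have lin: "lin (act A)" for A
    using matrix_vector_mul_linear_gen[of "transpose A"]
    unfolding act_def transpose_matrix_vector[symmetric] .
  have pow: "(act A ^^ k) v = v v* matpow A k" for A k v
    by (induction k arbitrary: v)
      (simp_all add: act_def funpow_Suc_right vector_matrix_mul_assoc del: funpow.simps(2))
  \<comment> \<open>With \<open>M\<close> the dimension of the nilspace, \<open>k0 \<le> m0 \<le> M\<close> turns \<open>k0 + m0 / 2 > n\<close> into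
    \<open>3 * M > 2 * n\<close>.\<close>
  have dim: "vec.dim (nilspace (act A)) \<in> {t..n}" if "A \<in> ?E" for A
  proof -
    have "{v. v v* A = 0} \<subseteq> {v. v v* matpow A n = 0}"
      using assms(3) by (cases n) (auto simp flip: vector_matrix_mul_assoc)
    then have "k0 A \<le> m0 A"
      unfolding assms by (rule vec.dim_subset)
    moreover have "{v. v v* matpow A n = 0} \<subseteq> nilspace (act A)"
      by (auto simp: nilspace_def pow)
    then have "m0 A \<le> vec.dim (nilspace (act A))"
      unfolding assms by (rule vec.dim_subset)
    moreover have "vec.dim (nilspace (act A)) \<le> n"
      using vec.dim_subset_UNIV[of "nilspace (act A)"] assms by (simp add: card_cart_basis vec.dimension_def)
    ultimately show ?thesis
      using that by (simp add: t_def nat_le_iff ceiling_le_iff)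
  qed
  have "inj act"
  proof (rule injI)
    fix A B assume "act A = act B"
    then have "transpose A *v v = transpose B *v v" for v
      by (simp add: act_def fun_eq_iff)
    then have "transpose A = transpose B" by (simp add: matrix_eq)
    then show "A = B" by (metis transpose_transpose)
  qed
  then have "card ?E = card (act ` ?E)" by (simp add: card_image inj_on_subset)
  also have "\<dots> \<le> card (\<Union>m\<in>{t..n}. N m)"
    using dim lin by (intro card_mono) (auto simp: N_def)
  also have "\<dots> \<le> (\<Sum>m=t..n. card (N m))" by (rule card_UN_le) simp
  finally have "real (card ?E) \<le> (\<Sum>m=t..n. real (card (N m)))"
    by (simp flip: of_nat_sum)
  also have "\<dots> \<le> (\<Sum>m=t..n. real q ^ (n * n) * x ^ m)"
  proof (rule sum_mono)
    fix m
    have "real (card (N m)) * real q ^ m \<le> real q ^ (n * n)"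
      using card_nilspace_dim[where 'a='a and 'n='n, of m] assms by (simp add: N_def)
    then show "real (card (N m)) \<le> real q ^ (n * n) * x ^ m"
      using q by (simp add: x_def field_simps)
  qed
  finally have card: "real (card ?E) \<le> real q ^ (n * n) * (\<Sum>m=t..n. x ^ m)"
    by (simp add: sum_distrib_left)
  have "\<pi> = real (card ?E) / real q ^ (n * n)"
    unfolding assms(6) by (subst measure_pmf_of_set) (auto simp: assms power_mult)
  also have "\<dots> \<le> (\<Sum>m=t..n. x ^ m)"
    using card q by (simp add: field_simps)
  also have "\<dots> < 2 * x ^ t"
  proof -
    have x: "0 < x" "x \<le> 1 / 2" using q by (auto simp: x_def field_simps)
    have "t \<le> n" by (simp add: t_def nat_le_iff ceiling_le_iff)
    then have "(1 - x) * (\<Sum>m=t..n. x ^ m) = x ^ t - x ^ Suc n"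
      by (rule sum_gp_multiplied)
    also have "\<dots> < x ^ t" using x by simp
    also have "\<dots> \<le> (1 - x) * (2 * x ^ t)" using x by (simp add: field_simps)
    finally show ?thesis using x by (simp add: mult_less_cancel_left_pos)
  qed
  also have "x ^ t = real q powi (- \<lceil>2 * real n / 3\<rceil>)"
    by (simp add: x_def t_def power_int_def field_simps)
  finally show ?thesis .
qed

end
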